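(* Every strong semicomplete composition $Q=T[H_1,\dots,H_t]$ with at least four vertices has two distinct vertices $v_1,v_2$ such that $Q-v_i$ is strong for each $i\in\{1,2\}$.
   Context: Digraphs are finite, without loops or parallel arcs (2-cycles are allowed). A digraph is semicomplete if there is at least one arc between every pair of distinct vertices. Let $T$ be a digraph with vertices $u_1,\dots,u_t$ ($t\ge 2$) and let $H_1,\dots,H_t$ be pairwise disjoint nonempty digraphs, where $H_i$ has $n_i$ vertices. The composition $Q=T[H_1,\dots,H_t]$ is the digraph with vertex set $\bigcup_i V(H_i)$ and arc set $\bigcup_{i=1}^t A(H_i)\cup\{xy : x\in V(H_i),\ y\in V(H_p),\ u_iu_p\in A(T)\}$. It is a semicomplete composition if $T$ is semicomplete. A digraph is strong if for every ordered pair of vertices $(x,y)$ there is a directed path from $x$ to $y$. *)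

theory Defs
  imports "Graph_Theory.Graph_Theory" "HOL-Library.Disjoint_Sets"
begin

definition semicomplete :: "('a, 'b) pre_digraph \<Rightarrow> bool" where
  "semicomplete G \<longleftrightarrow>
    (\<forall>u\<in>verts G. \<forall>v\<in>verts G. u \<noteq> v \<longrightarrow> u \<rightarrow>\<^bsub>G\<^esub> v \<or> v \<rightarrow>\<^bsub>G\<^esub> u)"

text \<open>
  The digraph that is substituted for a vertex \<open>u\<close> of \<open>T\<close> is \<open>H u\<close>: the factors are indexed by the
  vertices of \<open>T\<close> themselves rather than by an enumeration \<open>1, \<dots>, t\<close> of them.
\<close>
definition composition ::
    "'t pair_pre_digraph \<Rightarrow> ('t \<Rightarrow> 'a pair_pre_digraph) \<Rightarrow> 'a pair_pre_digraph" where
  "composition T H =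
    \<lparr> pverts = (\<Union>u\<in>pverts T. pverts (H u)),
      parcs = (\<Union>u\<in>pverts T. parcs (H u)) \<union>
              {(x, y). \<exists>u w. (u, w) \<in> parcs T \<and> x \<in> pverts (H u) \<and> y \<in> pverts (H w)} \<rparr>"

lemma pair_digraph_composition:
  assumes "pair_digraph T"
    and H: "\<And>u. u \<in> pverts T \<Longrightarrow> pair_digraph (H u)"
    and disj: "disjoint_family_on (\<lambda>u. pverts (H u)) (pverts T)"
  shows "pair_digraph (composition T H)"
proof -
  interpret T: pair_digraph T by fact
  let ?Q = "composition T H"
  have fin: "finite (pverts ?Q)"
    using H by (auto simp: composition_def pair_digraph_def pair_fin_digraph_def
        pair_fin_digraph_axioms_def)
  have sub: "x \<in> pverts ?Q \<and> y \<in> pverts ?Q \<and> x \<noteq> y" if xy: "(x, y) \<in> parcs ?Q" for x y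
  proof -
    consider u where "u \<in> pverts T" "(x, y) \<in> parcs (H u)"
      | u w where "(u, w) \<in> parcs T" "x \<in> pverts (H u)" "y \<in> pverts (H w)"
      using xy by (auto simp: composition_def)
    then show ?thesis
    proof cases
      case 1
      interpret Hu: pair_digraph "H u" by (rule H) fact
      have "x \<in> pverts (H u)" "y \<in> pverts (H u)" "x \<noteq> y"
        using 1(2) Hu.wellformed' Hu.no_loops' by blast+
      then show ?thesis using 1(1) by (auto simp: composition_def)
    next
      case 2
      then have "u \<in> pverts T" "w \<in> pverts T" "u \<noteq> w"
        using T.wellformed' T.no_loops' by blast+
      then show ?thesis using 2 disj by (auto simp: composition_def disjoint_family_on_def)
    qed
  qed
  have "parcs ?Q \<subseteq> pverts ?Q \<times> pverts ?Q" using sub by auto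
  then have "finite (parcs ?Q)" using fin by (blast intro: finite_subset)
  with fin sub show ?thesis by unfold_locales force+
qed

end

theory Submission
  imports Defs
begin

text \<open>
  If some factor \<open>H u\<close> has two vertices, each of them can be deleted: what remains is still a
  composition over the strong digraph \<open>T\<close> with nonempty factors. Otherwise \<open>Q\<close> is itself
  semicomplete, and it suffices to find, for every vertex \<open>v\<close>, a deletable vertex \<open>w \<noteq> v\<close>; applying
  this twice gives two distinct ones. Let \<open>S\<close> be a maximal proper vertex set that contains \<open>v\<close> and
  induces a strong digraph. If \<open>S\<close> misses more than one vertex, maximality splits the rest into the
  set \<open>A\<close> of vertices dominating \<open>S\<close> and the set \<open>B\<close> of vertices dominated by \<open>S\<close>, and there is an
  arc from some \<open>b \<in> B\<close> to some \<open>a \<in> A\<close>. Then \<open>S \<union> {a, b}\<close> is strong, so it contains all vertices,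
  and any vertex of \<open>S\<close> other than \<open>v\<close> can be deleted, since \<open>x \<rightarrow> b \<rightarrow> a \<rightarrow> x\<close> for all \<open>x \<in> S\<close>.
\<close>

section \<open>Strongness of induced subdigraphs, with the arc relation kept fixed\<close>

definition strong_on :: "'a rel \<Rightarrow> 'a set \<Rightarrow> bool" where
  "strong_on r S \<longleftrightarrow> (\<forall>x\<in>S. \<forall>y\<in>S. (x, y) \<in> rtrancl_on S r)"

lemma strong_onI_hub:
  assumes "\<And>x. x \<in> S \<Longrightarrow> (x, h) \<in> rtrancl_on S r" "\<And>x. x \<in> S \<Longrightarrow> (h, x) \<in> rtrancl_on S r"
  shows "strong_on r S"
  unfolding strong_on_def using assms by (blast intro: rtrancl_on_trans)

lemma rtrancl_on_step:
  assumes "(x, y) \<in> r" "x \<in> S" "y \<in> S"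
  shows "(x, y) \<in> rtrancl_on S r"
  using assms by (blast intro: rtrancl_on_into_rtrancl_on)

lemma rtrancl_on_step2:
  assumes "(x, y) \<in> r" "(y, z) \<in> r" "x \<in> S" "y \<in> S" "z \<in> S"
  shows "(x, z) \<in> rtrancl_on S r"
  using assms by (blast intro: rtrancl_on_into_rtrancl_on)

lemma strong_on_rtrancl_on_superset:
  assumes "strong_on r S" "S \<subseteq> V" "x \<in> S" "y \<in> S"
  shows "(x, y) \<in> rtrancl_on V r"
  using assms rtrancl_on_mono[of r r S V] unfolding strong_on_def by blast

text \<open>All of \<open>S\<close> reaches \<open>w\<close> through \<open>s\<close>, and
  \<open>w\<close> reaches all of \<open>S\<close> through \<open>t\<close>. Read contrapositively,
  this constrains the vertices outside a maximal strong set.\<close>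

lemma strong_on_insert:
  assumes S: "strong_on r S" and s: "s \<in> S" "(s, w) \<in> r" and t: "t \<in> S" "(w, t) \<in> r"
  shows "strong_on r (insert w S)"
proof (rule strong_onI_hub[where h = w])
  let ?V = "insert w S"
  have sw: "(s, w) \<in> rtrancl_on ?V r" and wt: "(w, t) \<in> rtrancl_on ?V r"
    using s t by (auto intro: rtrancl_on_step)
  have old: "(x, y) \<in> rtrancl_on ?V r" if "x \<in> S" "y \<in> S" for x y
    by (rule strong_on_rtrancl_on_superset[OF S _ that]) blast
  show "(x, w) \<in> rtrancl_on ?V r" if "x \<in> ?V" for x
    using that old[OF _ s(1)] sw by (blast intro: rtrancl_on_trans)
  show "(w, x) \<in> rtrancl_on ?V r" if "x \<in> ?V" for x
    using that old[OF t(1)] wt by (blast intro: rtrancl_on_trans)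
qed

text \<open>A walk that starts in \<open>X\<close> and uses no arc out of \<open>X\<close> stays in
  \<open>X\<close>.\<close>

lemma strong_on_arc_leaving:
  assumes "strong_on r V" "x \<in> X" "X \<subseteq> V" "y \<in> V - X"
  obtains a b where "a \<in> X" "b \<in> V - X" "(a, b) \<in> r"
proof -
  have "(x, y) \<in> rtrancl_on V r" using assms by (auto simp: strong_on_def)
  then have "y \<in> X \<or> (\<exists>a\<in>X. \<exists>b\<in>V - X. (a, b) \<in> r)"
    using assms(2) by induct auto
  with assms(4) that show thesis by blast
qed

section \<open>Deletable vertices of semicomplete digraphs\<close>

lemma semicomplete_deletable_vertex_avoiding:
  assumes fin: "finite V" and card: "card V \<ge> 4" and strong: "strong_on r V"
    and semi: "\<And>x y. x \<in> V \<Longrightarrow> y \<in> V \<Longrightarrow> x \<noteq> y \<Longrightarrow> (x, y) \<in> r \<or> (y, x) \<in> r"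
    and v: "v \<in> V"
  shows "\<exists>w\<in>V - {v}. strong_on r (V - {w})"
proof -
  let ?F = "{S. v \<in> S \<and> S \<subset> V \<and> strong_on r S}"
  have "V \<noteq> {v}" using card by auto
  then have "{v} \<in> ?F" using v by (auto simp: strong_on_def)
  moreover have "finite ?F" using fin by (auto intro: finite_subset[of _ "Pow V"])
  ultimately obtain S where "S \<in> ?F" and Smax: "\<And>S'. S' \<in> ?F \<Longrightarrow> S \<subseteq> S' \<Longrightarrow> S = S'"
    using finite_has_maximal[of ?F] by (metis (no_types, lifting) empty_iff)
  then have S: "v \<in> S" "S \<subset> V" "strong_on r S" by auto
  show ?thesis
  proof (cases "\<exists>w\<in>V - S. insert w S = V")
    case True
    then obtain w where "w \<in> V - S" "insert w S = V" by blast
    then have "V - {w} = S" "w \<in> V - {v}" using S by auto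
    then show ?thesis using S by auto
  next
    case False
    define A where "A = {w \<in> V - S. \<forall>s\<in>S. (w, s) \<in> r \<and> (s, w) \<notin> r}"
    define B where "B = {w \<in> V - S. \<forall>s\<in>S. (s, w) \<in> r \<and> (w, s) \<notin> r}"
    \<comment> \<open>By maximality \<open>w\<close> cannot have both an arc from \<open>S\<close>
      and an arc to \<open>S\<close>; semicompleteness then orients all pairs between
      \<open>w\<close> and \<open>S\<close> the same way.\<close>
    have AB: "w \<in> A \<union> B" if w: "w \<in> V - S" for w
    proof -
      have "insert w S \<notin> ?F" using Smax[of "insert w S"] w by auto
      moreover have "insert w S \<subset> V" using False w S by auto
      ultimately have ns: "\<not> strong_on r (insert w S)" using S by auto
      have "(s, w) \<notin> r \<or> (w, t) \<notin> r" if "s \<in> S" "t \<in> S" for s t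
        using ns strong_on_insert[OF S(3)] that by blast
      moreover have "(s, w) \<in> r \<or> (w, s) \<in> r" if "s \<in> S" for s
        using semi[of s w] that w S by blast
      ultimately show ?thesis using w unfolding A_def B_def by blast
    qed
    have "B \<subseteq> V" and SB: "S \<inter> B = {}" "S \<inter> A = {}" by (auto simp: A_def B_def)
    \<comment> \<open>Otherwise all vertices outside \<open>S\<close> lie in \<open>B\<close>, and
      no arc leads back from \<open>B\<close> to \<open>S\<close>.\<close>
    have "A \<noteq> {}"
    proof
      assume "A = {}"
      then have VB: "V - B = S" using AB S SB by blast
      obtain b0 where "b0 \<in> B" using AB S \<open>A = {}\<close> by blast
      moreover have "v \<in> V - B" using S VB by blast
      ultimately obtain b s where "b \<in> B" "s \<in> V - B" "(b, s) \<in> r"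
        using strong_on_arc_leaving[OF strong _ \<open>B \<subseteq> V\<close>] by metis
      then show False using VB by (auto simp: B_def)
    qed
    then obtain a0 where "a0 \<in> A" by blast
    then have "a0 \<in> V - (S \<union> B)" using S by (auto simp: A_def B_def)
    \<comment> \<open>An arc leaving \<open>S \<union> B\<close> must end in \<open>A\<close>; it
      cannot start in \<open>S\<close>, since no arc goes from \<open>S\<close> to \<open>A\<close>.
      So it starts in \<open>B\<close>.\<close>
    then obtain b a where ba: "b \<in> S \<union> B" "a \<in> V - (S \<union> B)" "(b, a) \<in> r"
      using strong_on_arc_leaving[OF strong, of v "S \<union> B" a0] S \<open>B \<subseteq> V\<close> by blast
    then have a: "a \<in> A" using AB by blast
    with ba have b: "b \<in> B" by (auto simp: A_def)
    have aS: "(a, s) \<in> r" and Sb: "(s, b) \<in> r" if "s \<in> S" for s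
      using a b that by (auto simp: A_def B_def)
    let ?U = "insert a (insert b S)"
    \<comment> \<open>The closed walk \<open>v\<close>, \<open>b\<close>, \<open>a\<close>,
      \<open>v\<close> attaches both new vertices to the strong set \<open>S\<close>.\<close>
    have "strong_on r ?U"
    proof (rule strong_onI_hub[where h = v])
      have old: "(x, y) \<in> rtrancl_on ?U r" if "x \<in> S" "y \<in> S" for x y
        by (rule strong_on_rtrancl_on_superset[OF S(3) _ that]) blast
      show "(x, v) \<in> rtrancl_on ?U r" if x: "x \<in> ?U" for x
      proof -
        consider "x = a" | "x = b" | "x \<in> S" using x by blast
        then show ?thesis
          using old[OF _ S(1), of x] S(1) rtrancl_on_step[OF aS[OF S(1)], of ?U]
            rtrancl_on_step2[OF ba(3) aS[OF S(1)], of ?U]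
          by cases auto
      qed
      show "(v, x) \<in> rtrancl_on ?U r" if x: "x \<in> ?U" for x
      proof -
        consider "x = a" | "x = b" | "x \<in> S" using x by blast
        then show ?thesis
          using old[OF S(1), of x] S(1) rtrancl_on_step[OF Sb[OF S(1)], of ?U]
            rtrancl_on_step2[OF Sb[OF S(1)] ba(3), of ?U]
          by cases auto
      qed
    qed
    moreover have "?U \<subseteq> V" "S \<noteq> ?U" using S a b by (auto simp: A_def B_def)
    ultimately have U: "?U = V" using Smax[of ?U] S by blast
    have "finite S" using S fin by (auto intro: finite_subset)
    \<comment> \<open>Four vertices in \<open>V = ?U\<close> leave at least two in \<open>S\<close>,
      hence one other than \<open>v\<close>.\<close>
    then have "card V \<le> card S + 2" using card_insert_le_m1[of "card S + 2" "insert b S" a]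
        card_insert_le_m1[of "card S + 1" S b] U by auto
    then have "S \<noteq> {v}" using card by auto
    then obtain s where s: "s \<in> S" "s \<noteq> v" using S by blast
    let ?W = "V - {s}"
    have W: "?W = insert a (insert b (S - {s}))" using U s a b by (auto simp: A_def B_def)
    have mem: "a \<in> ?W" "b \<in> ?W" "v \<in> ?W" using W S s by auto
    \<comment> \<open>\<open>S - {s}\<close> may fail to be strong, so walks now run through
      \<open>a\<close> and \<open>b\<close>; the walk from \<open>a\<close> to \<open>b\<close>
      passes through \<open>v\<close>, which was kept.\<close>
    have "strong_on r ?W"
    proof (rule strong_onI_hub[where h = a])
      show "(x, a) \<in> rtrancl_on ?W r" if x: "x \<in> ?W" for x
      proof -
        consider "x = a" | "x = b" | "x \<in> S" using x W by blast
        then show ?thesis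
          using x mem rtrancl_on_step[OF ba(3), of ?W] rtrancl_on_step2[OF Sb ba(3), of x ?W]
          by cases auto
      qed
      show "(a, x) \<in> rtrancl_on ?W r" if x: "x \<in> ?W" for x
      proof -
        consider "x = a" | "x = b" | "x \<in> S" using x W by blast
        then show ?thesis
          using x mem rtrancl_on_step[OF aS, of x ?W]
            rtrancl_on_step2[OF aS[OF S(1)] Sb[OF S(1)], of ?W]
          by cases auto
      qed
    qed
    then show ?thesis using s S by blast
  qed
qed

section \<open>Translation to \<open>strongly_connected\<close>\<close>

lemma strongly_connected_with_proj_iff:
  "strongly_connected (with_proj G) \<longleftrightarrow> pverts G \<noteq> {} \<and> strong_on (parcs G) (pverts G)"
  by (simp add: strongly_connected_def strong_on_def reachable_def)

text \<open>Walks confined to \<open>pverts G - {v}\<close> use only arcs that survive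
  \<open>del_vert\<close>. Nonemptiness is asked for separately because \<open>strong_on\<close>
  holds for the empty set.\<close>

lemma strongly_connected_del_vertI:
  assumes "strong_on (parcs G) (pverts G - {v})" "pverts G - {v} \<noteq> {}"
  shows "strongly_connected (pre_digraph.del_vert (with_proj G) v)"
proof -
  let ?D = "pre_digraph.del_vert (with_proj G) v"
  have ends: "arcs_ends ?D = {(x, y) \<in> parcs G. x \<noteq> v \<and> y \<noteq> v}"
    by (force simp: arcs_ends_conv pre_digraph.del_vert_simps)
  have "(x, y) \<in> rtrancl_on (pverts G - {v}) (arcs_ends ?D)"
    if "(x, y) \<in> rtrancl_on (pverts G - {v}) (parcs G)" for x y
    using that
  proof induct
    case (step y z)
    then show ?case by (auto simp: ends intro: converse_rtrancl_on_into_rtrancl_on)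
  qed auto
  then show ?thesis
    using assms by (simp add: strongly_connected_def strong_on_def reachable_def pre_digraph.del_vert_simps)
qed

section \<open>Walks in a composition versus walks in \<open>T\<close>\<close>

locale composed =
  fixes T :: "'t pair_pre_digraph" and H :: "'t \<Rightarrow> 'a pair_pre_digraph"
  assumes T: "pair_digraph T"
    and H: "\<And>u. u \<in> pverts T \<Longrightarrow> pair_digraph (H u)"
    and nonempty: "\<And>u. u \<in> pverts T \<Longrightarrow> pverts (H u) \<noteq> {}"
    and disj: "disjoint_family_on (\<lambda>u. pverts (H u)) (pverts T)"
begin

abbreviation "Q \<equiv> composition T H"

lemma pverts_Q: "pverts Q = (\<Union>u\<in>pverts T. pverts (H u))"
  by (simp add: composition_def)

lemma factor_unique:
  assumes "u \<in> pverts T" "w \<in> pverts T" "x \<in> pverts (H u)" "x \<in> pverts (H w)"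
  shows "u = w"
  using assms disj by (auto simp: disjoint_family_on_def)

lemma parcs_T_pverts: "(u, w) \<in> parcs T \<Longrightarrow> u \<in> pverts T \<and> w \<in> pverts T"
  using T pair_wf_digraph.wellformed'
  unfolding pair_digraph_def pair_fin_digraph_def by metis

text \<open>Projecting a walk to \<open>T\<close>, an arc inside a factor collapses to a point and
  an arc between factors becomes an arc of \<open>T\<close>; disjointness makes the projection well
  defined.\<close>

lemma rtrancl_on_Q_imp_rtrancl_T:
  assumes "(x, y) \<in> rtrancl_on (pverts Q) (parcs Q)"
    and "u \<in> pverts T" "x \<in> pverts (H u)" "w \<in> pverts T" "y \<in> pverts (H w)"
  shows "(u, w) \<in> (parcs T)\<^sup>*"
  using assms(1,4,5)
proof (induct arbitrary: w rule: rtrancl_on_induct)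
  case base
  then show ?case using factor_unique assms(2,3) by blast
next
  case (step y z)
  then consider p where "p \<in> pverts T" "(y, z) \<in> parcs (H p)"
    | p q where "(p, q) \<in> parcs T" "y \<in> pverts (H p)" "z \<in> pverts (H q)"
    by (auto simp: composition_def)
  then show ?case
  proof cases
    case 1
    interpret Hp: pair_digraph "H p" by (rule H) fact
    have "y \<in> pverts (H p)" "z \<in> pverts (H p)" using 1 Hp.wellformed' by blast+
    then show ?thesis using step factor_unique 1 by blast
  next
    case 2
    then have "(u, p) \<in> (parcs T)\<^sup>*" using step parcs_T_pverts by blast
    moreover have "q = w" using 2 step factor_unique parcs_T_pverts by blast
    ultimately show ?thesis using 2 by auto
  qed
qed

text \<open>A walk of \<open>T\<close> lifts by choosing representatives in \<open>W\<close>. It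
  must have positive length: two vertices of one factor are joined by leaving the factor and
  returning.\<close>

lemma trancl_T_imp_rtrancl_on_Q:
  assumes "(u, w) \<in> (parcs T)\<^sup>+" and "x \<in> pverts (H u) \<inter> W" "y \<in> pverts (H w) \<inter> W"
    and W: "\<And>p. p \<in> pverts T \<Longrightarrow> pverts (H p) \<inter> W \<noteq> {}"
  shows "(x, y) \<in> rtrancl_on W (parcs Q)"
  using assms(1,3)
proof (induct arbitrary: y)
  case (base w)
  then have "(x, y) \<in> parcs Q" using assms(2) by (auto simp: composition_def)
  then show ?case using base assms(2) by (auto intro: rtrancl_on_step)
next
  case (step p q)
  then obtain z where z: "z \<in> pverts (H p) \<inter> W" using W parcs_T_pverts by blast
  then have "(x, z) \<in> rtrancl_on W (parcs Q)" using step by blast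
  moreover have "(z, y) \<in> parcs Q" using z step by (auto simp: composition_def)
  ultimately show ?case using step by (auto intro: rtrancl_on_into_rtrancl_on)
qed

lemma strong_imp_trancl_T:
  assumes "strong_on (parcs Q) (pverts Q)" "card (pverts T) \<ge> 2"
    and u: "u \<in> pverts T" and w: "w \<in> pverts T"
  shows "(u, w) \<in> (parcs T)\<^sup>+"
proof -
  have reach: "(p, q) \<in> (parcs T)\<^sup>*" if p: "p \<in> pverts T" and q: "q \<in> pverts T" for p q
  proof -
    obtain x y where "x \<in> pverts (H p)" "y \<in> pverts (H q)" using nonempty p q by blast
    moreover from this have "(x, y) \<in> rtrancl_on (pverts Q) (parcs Q)"
      using assms(1) p q by (auto simp: strong_on_def pverts_Q)
    ultimately show ?thesis using rtrancl_on_Q_imp_rtrancl_T p q by blast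
  qed
  have "pverts T \<noteq> {u}" using assms(2) by auto
  \<comment> \<open>The detour through \<open>p\<close> gives positive length even when
    \<open>u = w\<close>.\<close>
  then obtain p where p: "p \<in> pverts T" "p \<noteq> u" using u by blast
  then have "(u, p) \<in> (parcs T)\<^sup>+" using reach[OF u p(1)] by (auto simp: rtrancl_eq_or_trancl)
  then show ?thesis using reach[OF p(1) w] by (rule trancl_rtrancl_trancl)
qed

text \<open>Since \<open>y\<close> stays behind, every factor still meets the remaining vertex set,
  so walks of \<open>T\<close> lift into it.\<close>

lemma strong_on_delete_in_large_factor:
  assumes "strong_on (parcs Q) (pverts Q)" "card (pverts T) \<ge> 2"
    and u: "u \<in> pverts T" and x: "x \<in> pverts (H u)" "y \<in> pverts (H u)" "x \<noteq> y"
  shows "strong_on (parcs Q) (pverts Q - {x})"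
proof -
  let ?W = "pverts Q - {x}"
  have W: "pverts (H p) \<inter> ?W \<noteq> {}" if p: "p \<in> pverts T" for p
  proof (cases "p = u")
    case True
    then show ?thesis using x u by (auto simp: pverts_Q)
  next
    case False
    obtain z where "z \<in> pverts (H p)" using nonempty[OF p] by blast
    moreover from this have "z \<noteq> x" using False factor_unique p u x by blast
    ultimately show ?thesis using p by (auto simp: pverts_Q)
  qed
  show ?thesis
    unfolding strong_on_def
  proof (intro ballI)
    fix a b assume ab: "a \<in> ?W" "b \<in> ?W"
    then obtain p q where pq: "p \<in> pverts T" "a \<in> pverts (H p)" "q \<in> pverts T" "b \<in> pverts (H q)"
      by (auto simp: pverts_Q)
    then have "(p, q) \<in> (parcs T)\<^sup>+" using strong_imp_trancl_T assms by blast
    then show "(a, b) \<in> rtrancl_on ?W (parcs Q)"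
      using trancl_T_imp_rtrancl_on_Q[where W = ?W] W pq ab by blast
  qed
qed

end

section \<open>Case distinction on the factor sizes\<close>

theorem theorem2p5:
  fixes T :: "'t pair_pre_digraph" and H :: "'t \<Rightarrow> 'a pair_pre_digraph"
    and Q :: "'a pair_pre_digraph"
  assumes "pair_digraph T" and "card (pverts T) \<ge> 2"
    and "\<And>u. u \<in> pverts T \<Longrightarrow> pair_digraph (H u)"
    and "\<And>u. u \<in> pverts T \<Longrightarrow> pverts (H u) \<noteq> {}"
    and "disjoint_family_on (\<lambda>u. pverts (H u)) (pverts T)"
    and "Q = composition T H"
    and "semicomplete (with_proj T)"
    and "strongly_connected (with_proj Q)"
    and "card (pverts Q) \<ge> 4"
  shows "\<exists>v1\<in>pverts Q. \<exists>v2\<in>pverts Q. v1 \<noteq> v2 \<and>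
           strongly_connected (pre_digraph.del_vert (with_proj Q) v1) \<and>
           strongly_connected (pre_digraph.del_vert (with_proj Q) v2)"
proof -
  interpret C: composed T H using assms(1,3,4,5) by (rule composed.intro)
  have strong: "strong_on (parcs Q) (pverts Q)"
    using assms(8) by (simp add: strongly_connected_with_proj_iff)
  have "\<exists>v1\<in>pverts Q. \<exists>v2\<in>pverts Q. v1 \<noteq> v2 \<and>
          strong_on (parcs Q) (pverts Q - {v1}) \<and> strong_on (parcs Q) (pverts Q - {v2})"
  proof (cases "\<exists>u\<in>pverts T. \<exists>x\<in>pverts (H u). \<exists>y\<in>pverts (H u). x \<noteq> y")
    case True
    then obtain u x y where "u \<in> pverts T" "x \<in> pverts (H u)" "y \<in> pverts (H u)" "x \<noteq> y"
      by blast
    \<comment> \<open>The two vertices are \<open>x\<close> and \<open>y\<close>, whose roles are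
      symmetric.\<close>
    then show ?thesis
      using C.strong_on_delete_in_large_factor strong assms(2,6) C.pverts_Q
      by (metis UN_I)
  next
    case False
    \<comment> \<open>All factors are singletons, so distinct vertices lie in distinct factors and
      inherit an arc from \<open>T\<close>.\<close>
    have semi: "(x, y) \<in> parcs Q \<or> (y, x) \<in> parcs Q"
      if xy: "x \<in> pverts Q" "y \<in> pverts Q" "x \<noteq> y" for x y
    proof -
      obtain u w where uw: "u \<in> pverts T" "x \<in> pverts (H u)" "w \<in> pverts T" "y \<in> pverts (H w)"
        using xy assms(6) by (auto simp: C.pverts_Q)
      then have "u \<noteq> w" using False xy by blast
      then have "(u, w) \<in> parcs T \<or> (w, u) \<in> parcs T"
        using assms(7) uw by (auto simp: semicomplete_def)
      then show ?thesis using uw assms(6) by (auto simp: composition_def)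
    qed
    have fin: "finite (pverts Q)" using assms(9) by (intro card_ge_0_finite) simp
    note avoid = semicomplete_deletable_vertex_avoiding[OF fin assms(9) strong semi]
    \<comment> \<open>The vertex \<open>v\<close> is arbitrary and only serves to produce
      \<open>v1\<close>; avoiding \<open>v1\<close> then yields a second vertex.\<close>
    obtain v where "v \<in> pverts Q" using assms(9) by fastforce
    then obtain v1 where v1: "v1 \<in> pverts Q" "strong_on (parcs Q) (pverts Q - {v1})"
      using avoid[of v] by blast
    then show ?thesis using avoid[of v1] by blast
  qed
  moreover have "pverts Q - {v} \<noteq> {}" for v
    using assms(9) card_mono[of "{v}" "pverts Q"] by auto
  ultimately show ?thesis using strongly_connected_del_vertI by metis
qed

end
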